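(* Let $G$ be a finite powerful $2$-group and let $N$ be a normal subgroup of $G$ with $N\leq G^{4}$. Then $N$ is powerfully nilpotent.
   Context: For a finite group $H$ and a positive integer $n$, $H^{n}=\langle x^{n} : x\in H\rangle$ denotes the subgroup generated by all $n$-th powers of elements of $H$. A finite $2$-group $H$ is powerful if $[H,H]\leq H^{4}$. A powerful $2$-group $H$ is powerfully nilpotent if it has an ascending chain of subgroups $\{1\}=H_{0}\leq H_{1}\leq\dots\leq H_{n}=H$ such that $[H_{i},H]\leq H_{i-1}^{2}$ for $i=1,\dots,n$. In particular, being powerfully nilpotent includes being powerful. *)

theory Defs
  imports "HOL-Algebra.Algebra"
begin

text \<open>For a subgroup \<open>K\<close> of \<open>G\<close>, the subgroup \<open>K\<^sup>n\<close> generated by the \<open>n\<close>-th powers of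
  elements of \<open>K\<close>; like \<^const>\<open>derived\<close>, it is formed inside the ambient group \<open>G\<close>.\<close>

definition power_subgroup :: "('a, 'b) monoid_scheme \<Rightarrow> 'a set \<Rightarrow> nat \<Rightarrow> 'a set"
  where "power_subgroup G K n = generate G ((\<lambda>x. x [^]\<^bsub>G\<^esub> n) ` K)"

text \<open>The commutator convention is that of \<^const>\<open>derived\<close>.\<close>

definition commutator_subgroup :: "('a, 'b) monoid_scheme \<Rightarrow> 'a set \<Rightarrow> 'a set \<Rightarrow> 'a set"
  where "commutator_subgroup G A B =
    generate G (\<Union>a\<in>A. \<Union>b\<in>B. {a \<otimes>\<^bsub>G\<^esub> b \<otimes>\<^bsub>G\<^esub> inv\<^bsub>G\<^esub> a \<otimes>\<^bsub>G\<^esub> inv\<^bsub>G\<^esub> b})"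

lemma commutator_subgroup_self: "commutator_subgroup G A A = derived G A"
  by (simp add: commutator_subgroup_def derived_def)

definition finite_2_group :: "('a, 'b) monoid_scheme \<Rightarrow> bool"
  where "finite_2_group G \<longleftrightarrow> group G \<and> finite (carrier G) \<and> (\<exists>k::nat. order G = 2 ^ k)"

definition powerful_2_group :: "('a, 'b) monoid_scheme \<Rightarrow> bool"
  where "powerful_2_group G \<longleftrightarrow>
    finite_2_group G \<and> derived G (carrier G) \<subseteq> power_subgroup G (carrier G) 4"

definition powerfully_nilpotent_2_group :: "('a, 'b) monoid_scheme \<Rightarrow> bool"
  where "powerfully_nilpotent_2_group G \<longleftrightarrow>
    powerful_2_group G \<and>
    (\<exists>(n::nat) (H :: nat \<Rightarrow> 'a set).
       H 0 = {\<one>\<^bsub>G\<^esub>} \<and> H n = carrier G \<and>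
       (\<forall>i\<le>n. subgroup (H i) G) \<and>
       (\<forall>i<n. H i \<subseteq> H (Suc i)) \<and>
       (\<forall>i<n. commutator_subgroup G (H (Suc i)) (carrier G) \<subseteq> power_subgroup G (H i) 2))"

end

theory Submission
  imports Defs
begin

text \<open>
  Write \<open>E\<^sub>i\<close> for the series \<open>E\<^sub>0 = G\<close>, \<open>E\<^sub>i\<^sub>+\<^sub>1 = E\<^sub>i\<^sup>2\<close>. In a finite powerful 2-group powers and
  commutators are well controlled along it: \<open>[E\<^sub>i, E\<^sub>j] \<le> E\<^sub>i\<^sub>+\<^sub>j\<^sub>+\<^sub>2\<close>, every element of \<open>E\<^sub>i\<close> is a
  \<open>2\<^sup>i\<close>-th power, and the series reaches the trivial group.

  Everything rests on one statement about orders of elements, in the spirit of Fernandez-Alcober's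
  work on omega subgroups of powerful groups: if \<open>x\<close> has order at most \<open>2\<^sup>s\<^sup>+\<^sup>1\<close> and \<open>y\<close> has order at
  most \<open>2\<^sup>s\<close>, then \<open>x\<close> raised to \<open>2\<^sup>a\<close> commutes with \<open>y\<close> raised to \<open>2\<^sup>b\<close> whenever \<open>a + b = s\<close>. It is applied
  in quotients \<open>G/D\<close>, that is, with ``order'' read modulo a normal subgroup \<open>D\<close>
  (lemma \<open>commuting_powers_normal\<close>). Given it, the theorem follows by choosing \<open>D\<close> and extracting
  roots in \<open>G\<close>, not in \<open>N\<close>.

  \<^item> For \<open>D = N\<^sup>4\<close>, two elements of \<open>N\<close> are fourth powers of elements whose order modulo \<open>D\<close> divides
    16. With \<open>s = 4\<close> and \<open>a = b = 2\<close> they commute modulo \<open>D\<close>, so \<open>[N, N] \<le> N\<^sup>4\<close>.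

  \<^item> The chain is formed by \<open>K\<^sub>k = N \<inter> E\<^sub>k\<close>, read from large \<open>k\<close> down to \<open>K\<^sub>2 = N\<close>. An element of \<open>K\<^sub>k\<close> is a
    \<open>2\<^sup>k\<close>-th power, an element of \<open>N\<close> is a fourth power, and modulo the square of \<open>K\<^sub>k\<^sub>+\<^sub>1\<close> the orders of the two
    roots are small enough to take \<open>s = k + 2\<close>. Hence \<open>[K\<^sub>k, N]\<close> lies in the square of \<open>K\<^sub>k\<^sub>+\<^sub>1\<close>.

  The statement on orders is proved by induction on the order of the group and, inside one group,
  by downward induction on \<open>s\<close>, since for large \<open>s\<close> all these commutators lie in a trivial
  \<open>E\<^sub>s\<^sub>+\<^sub>2\<close>. For \<open>s \<ge> 2\<close> the involutions of \<open>E\<^sub>s\<^sub>-\<^sub>1\<close> form an elementary abelian normal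
  subgroup \<open>\<Omega>\<close>; passing to \<open>G/\<Omega>\<close> lowers \<open>s\<close> by one and leaves only an involution as the error term,
  which the case \<open>s + 1\<close> removes. The heart is the claim that the square of an element of order
  dividing 4 commutes with every involution of \<open>E\<^sub>s\<^sub>-\<^sub>1\<close> (lemma \<open>square_commutes_with_involution\<close>); it serves both as
  the case \<open>s = 1\<close> and as the reason why \<open>\<Omega>\<close> is abelian.
\<close>

section \<open>Commutators\<close>

definition commutator :: "('a, 'b) monoid_scheme \<Rightarrow> 'a \<Rightarrow> 'a \<Rightarrow> 'a"
  where "commutator G a b = a \<otimes>\<^bsub>G\<^esub> b \<otimes>\<^bsub>G\<^esub> inv\<^bsub>G\<^esub> a \<otimes>\<^bsub>G\<^esub> inv\<^bsub>G\<^esub> b"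

context group
begin

abbreviation comm :: "'a \<Rightarrow> 'a \<Rightarrow> 'a"
  where "comm \<equiv> commutator G"

lemma cancel_inv:
  assumes "x \<in> carrier G" "y \<in> carrier G"
  shows "inv x \<otimes> (x \<otimes> y) = y" "x \<otimes> (inv x \<otimes> y) = y"
  using assms by (simp_all add: m_assoc [symmetric])

text \<open>Rewriting with these rules brings group words into freely reduced form, so that \<^emph>\<open>simp\<close> decides
  identities valid in all groups.\<close>

lemmas word = m_assoc inv_mult_group cancel_inv

lemma comm_closed [simp, intro]:
  "a \<in> carrier G \<Longrightarrow> b \<in> carrier G \<Longrightarrow> comm a b \<in> carrier G"
  by (simp add: commutator_def)

lemma comm_eq_one_iff:
  assumes "a \<in> carrier G" "b \<in> carrier G"
  shows "comm a b = \<one> \<longleftrightarrow> a \<otimes> b = b \<otimes> a"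
proof -
  have "comm a b = (a \<otimes> b) \<otimes> inv (b \<otimes> a)"
    using assms by (simp add: commutator_def word)
  then show ?thesis
    using assms by (metis inv_equality inv_inv l_inv m_closed inv_closed r_inv)
qed

lemma inv_comm:
  assumes "a \<in> carrier G" "b \<in> carrier G"
  shows "inv (comm a b) = comm b a"
  using assms by (simp add: commutator_def word)

lemma comm_mult_left:
  assumes "a \<in> carrier G" "b \<in> carrier G" "c \<in> carrier G"
  shows "comm (a \<otimes> b) c = a \<otimes> comm b c \<otimes> inv a \<otimes> comm a c"
  using assms by (simp add: commutator_def word)

lemma comm_inv_left:
  assumes "a \<in> carrier G" "b \<in> carrier G"
  shows "comm (inv a) b = inv a \<otimes> comm b a \<otimes> a"
  using assms by (simp add: commutator_def word)

text \<open>This identity drives all computations: modulo a normal subgroup containing the iterated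
  commutator, squaring an argument squares the commutator.\<close>

lemma comm_square_left:
  assumes "a \<in> carrier G" "b \<in> carrier G"
  shows "comm (a \<otimes> a) b = comm a (comm a b) \<otimes> (comm a b \<otimes> comm a b)"
  using assms by (simp add: commutator_def word)

lemma comm_swap_mem:
  assumes "subgroup D G" "a \<in> carrier G" "b \<in> carrier G" "comm a b \<in> D"
  shows "comm b a \<in> D"
  using assms inv_comm subgroup.m_inv_closed by metis

lemma normal_conj_mem:
  assumes "D \<lhd> G" "d \<in> D" "a \<in> carrier G"
  shows "a \<otimes> d \<otimes> inv a \<in> D" "inv a \<otimes> d \<otimes> a \<in> D"
  using assms normal.inv_op_closed1 normal.inv_op_closed2 by metis+

lemma comm_generate_mem:
  assumes "D \<lhd> G" "S \<subseteq> carrier G" "b \<in> carrier G"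
    and "\<And>s. s \<in> S \<Longrightarrow> comm s b \<in> D" and "a \<in> generate G S"
  shows "comm a b \<in> D"
proof -
  interpret D: normal D G by fact
  from \<open>a \<in> generate G S\<close> show ?thesis
  proof (induction rule: generate.induct)
    case one
    then show ?case
      using assms(3) by (simp add: commutator_def)
  next
    case (incl h)
    then show ?case using assms by simp
  next
    case (inv h)
    then have "h \<in> carrier G" "comm b h \<in> D"
      using assms comm_swap_mem D.subgroup_axioms by blast+
    then show ?case
      using assms(1,3) by (simp add: comm_inv_left normal_conj_mem)
  next
    case (eng h1 h2)
    then have "h1 \<in> carrier G" "h2 \<in> carrier G"
      using generate_in_carrier[OF assms(2)] by blast+
    then show ?case
      using assms(1,3) eng by (simp add: comm_mult_left normal_conj_mem)
  qed
qed

section \<open>Absorption in finite 2-groups\<close>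

text \<open>The class equation: all conjugacy classes of size greater than 1 have even size, so the class of
  the identity cannot be the only one of size 1. A power of a central element is then an involution.\<close>

lemma two_group_central_involution:
  assumes fin: "finite (carrier G)" and ord: "order G = 2 ^ k" and nontriv: "carrier G \<noteq> {\<one>}"
  shows "\<exists>z \<in> carrier G. z \<noteq> \<one> \<and> z \<otimes> z = \<one> \<and> (\<forall>g \<in> carrier G. z \<otimes> g = g \<otimes> z)"
proof -
  define \<phi> where "\<phi> = (\<lambda>g. \<lambda>h \<in> carrier G. g \<otimes> h \<otimes> inv g)"
  interpret act: group_action G "carrier G" \<phi>
    unfolding \<phi>_def by (rule action_by_conjugation)
  have orb: "orbit G \<phi> x = {g \<otimes> x \<otimes> inv g | g. g \<in> carrier G}" if "x \<in> carrier G" for x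
    using that by (auto simp: orbit_def \<phi>_def)
  have refl: "x \<in> orbit G \<phi> x" if "x \<in> carrier G" for x
    using act.orbit_refl that by blast
  have fin_orb: "finite (orbit G \<phi> x)" if "x \<in> carrier G" for x
    using fin that by (simp add: orb)
  have one_orb: "orbit G \<phi> \<one> = {\<one>}"
  proof
    show "orbit G \<phi> \<one> \<subseteq> {\<one>}" using orb[OF one_closed] by auto
    show "{\<one>} \<subseteq> orbit G \<phi> \<one>" using refl[OF one_closed] by simp
  qed
  have "\<exists>x \<in> carrier G. x \<noteq> \<one> \<and> orbit G \<phi> x = {x}"
  proof (rule ccontr)
    assume no: "\<not> ?thesis"
    have even: "even (card (orbit G \<phi> x))" if x: "x \<in> carrier G" "x \<noteq> \<one>" for x
    proof -
      have "card (orbit G \<phi> x) dvd 2 ^ k"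
        using act.orbit_stabilizer_theorem[OF x(1)] ord by (metis dvd_triv_left)
      then obtain j where j: "card (orbit G \<phi> x) = 2 ^ j"
        using divides_primepow_nat two_is_prime_nat by blast
      have "card (orbit G \<phi> x) \<noteq> 1"
        using no x refl by (metis card_1_singletonE singletonD)
      then show ?thesis using j by (cases j) auto
    qed
    have "(\<Sum>orb\<in>orbits G (carrier G) \<phi>. \<Sum>x\<in>orb. 1) = (\<Sum>x\<in>carrier G. (1::nat))"
      by (rule act.disjoint_sum[OF fin])
    then have "card (carrier G) = (\<Sum>orb\<in>orbits G (carrier G) \<phi>. card orb)"
      by simp
    moreover have "{\<one>} \<in> orbits G (carrier G) \<phi>"
      unfolding orbits_def using one_orb by force
    moreover have "finite (orbits G (carrier G) \<phi>)"
      unfolding orbits_def using fin by simp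
    ultimately have "card (carrier G) = 1 + (\<Sum>orb\<in>orbits G (carrier G) \<phi> - {{\<one>}}. card orb)"
      by (simp add: sum.remove)
    moreover have "even (\<Sum>orb\<in>orbits G (carrier G) \<phi> - {{\<one>}}. card orb)"
    proof (rule dvd_sum)
      fix orb assume "orb \<in> orbits G (carrier G) \<phi> - {{\<one>}}"
      then show "even (card orb)"
        unfolding orbits_def using even one_orb by auto
    qed
    ultimately have "odd (card (carrier G))"
      by simp
    then have "odd (2 ^ k :: nat)"
      using ord by (metis order_def)
    then have "card (carrier G) = 1"
      using ord by (cases k) (simp_all add: order_def)
    then show False
      using nontriv by (metis card_1_singletonE one_closed singletonD)
  qed
  then obtain x where x: "x \<in> carrier G" "x \<noteq> \<one>" "orbit G \<phi> x = {x}" by blast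
  have cen: "x \<otimes> g = g \<otimes> x" if "g \<in> carrier G" for g
  proof -
    have "g \<otimes> x \<otimes> inv g = x"
      using x that by (auto simp: orb)
    then show ?thesis
      using x that by (metis inv_closed m_assoc m_closed l_inv r_one)
  qed
  have pow1: "x [^] (2 ^ k :: nat) = \<one>"
    using pow_order_eq_1[OF x(1)] ord by simp
  define m where "m = (LEAST m. x [^] (2 ^ m :: nat) = \<one>)"
  have m1: "x [^] (2 ^ m :: nat) = \<one>"
    unfolding m_def using pow1 by (rule LeastI)
  then have "m \<noteq> 0" using x by (intro notI) simp
  then obtain l where l: "m = Suc l" using not0_implies_Suc by blast
  have nl: "x [^] (2 ^ l :: nat) \<noteq> \<one>"
    using not_less_Least[of l "\<lambda>m. x [^] (2 ^ m :: nat) = \<one>"] l m_def by auto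
  show ?thesis
  proof (intro bexI conjI ballI)
    show "x [^] (2 ^ l :: nat) \<otimes> x [^] (2 ^ l :: nat) = \<one>"
      using m1 l x by (simp add: nat_pow_mult mult_2)
    show "x [^] (2 ^ l :: nat) \<otimes> g = g \<otimes> x [^] (2 ^ l :: nat)" if "g \<in> carrier G" for g
      using cen[OF that] x that by (simp add: group_commutes_pow)
  qed (use x nl in auto)
qed

lemma coset_eq_one_iff:
  assumes "D \<lhd> G" "x \<in> carrier G"
  shows "D #> x = \<one>\<^bsub>G Mod D\<^esub> \<longleftrightarrow> x \<in> D"
proof -
  have "D #> x = D \<longleftrightarrow> x \<in> D"
    using assms coset_join1 coset_join2 normal_imp_subgroup subgroup.subset by metis
  then show ?thesis by simp
qed

lemma group_hom_FactGroup:
  assumes "D \<lhd> G"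
  shows "group_hom G (G Mod D) (\<lambda>x. D #> x)"
  using assms normal.factorgroup_is_group normal.r_coset_hom_Mod
  by (auto simp: group_hom_def group_hom_axioms_def)

lemma (in group_hom) hom_commutator:
  assumes "x \<in> carrier G" "y \<in> carrier G"
  shows "h (commutator G x y) = commutator H (h x) (h y)"
  using assms by (simp add: commutator_def)

lemma order_FactGroup_two_power:
  assumes "D \<lhd> G" "order G = 2 ^ k"
  shows "\<exists>j. order (G Mod D) = 2 ^ j"
proof -
  have "order (G Mod D) dvd 2 ^ k"
    using lagrange[OF normal_imp_subgroup[OF assms(1)]] assms(2)
    by (metis FactGroup_def dvd_triv_left order_def partial_object.simps(1))
  then show ?thesis
    using divides_primepow_nat two_is_prime_nat by blast
qed

lemma finite_FactGroup:
  assumes "finite (carrier G)"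
  shows "finite (carrier (G Mod D))"
  using assms by (simp add: carrier_FactGroup)

text \<open>The preimage in \<open>G\<close> of the elements of order at most 2 in the centre of \<open>G/T\<close>.\<close>

definition central_involutions_mod :: "'a set \<Rightarrow> 'a set"
  where "central_involutions_mod T =
    {x \<in> carrier G. (\<forall>g \<in> carrier G. comm x g \<in> T) \<and> x \<otimes> x \<in> T}"

lemma central_involutions_mod_normal:
  assumes "T \<lhd> G"
  shows "central_involutions_mod T \<lhd> G" "T \<subseteq> central_involutions_mod T"
proof -
  interpret T: normal T G by fact
  let ?Z = "central_involutions_mod T"
  show incl: "T \<subseteq> ?Z"
  proof
    fix t assume t: "t \<in> T"
    have "comm t g \<in> T" if "g \<in> carrier G" for g
    proof -
      have "comm t g = t \<otimes> (g \<otimes> inv t \<otimes> inv g)"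
        using t that by (simp add: commutator_def word)
      then show ?thesis
        using t that by (simp add: T.inv_op_closed2)
    qed
    then show "t \<in> ?Z"
      using t by (simp add: central_involutions_mod_def)
  qed
  have mult: "x \<otimes> y \<in> ?Z" if "x \<in> ?Z" "y \<in> ?Z" for x y
  proof -
    have car: "x \<in> carrier G" "y \<in> carrier G"
      using that by (auto simp: central_involutions_mod_def)
    have "comm (x \<otimes> y) g \<in> T" if g: "g \<in> carrier G" for g
      using that \<open>x \<in> ?Z\<close> \<open>y \<in> ?Z\<close> car assms
      by (simp add: comm_mult_left central_involutions_mod_def normal_conj_mem)
    moreover have "(x \<otimes> y) \<otimes> (x \<otimes> y) = (x \<otimes> comm y x \<otimes> inv x) \<otimes> ((x \<otimes> x) \<otimes> (y \<otimes> y))"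
      using car by (simp add: commutator_def word)
    moreover have "x \<otimes> comm y x \<otimes> inv x \<in> T" "x \<otimes> x \<in> T" "y \<otimes> y \<in> T"
      using that car assms by (auto simp: central_involutions_mod_def normal_conj_mem)
    ultimately show ?thesis
      using car by (simp add: central_involutions_mod_def)
  qed
  have inv: "inv x \<in> ?Z" if "x \<in> ?Z" for x
  proof -
    have car: "x \<in> carrier G"
      using that by (auto simp: central_involutions_mod_def)
    have "comm (inv x) g \<in> T" if g: "g \<in> carrier G" for g
      using comm_swap_mem[OF T.subgroup_axioms] g \<open>x \<in> ?Z\<close> car assms
      by (simp add: comm_inv_left central_involutions_mod_def normal_conj_mem)
    moreover have "inv x \<otimes> inv x = inv (x \<otimes> x)"
      using car by (simp add: inv_mult_group)
    ultimately show ?thesis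
      using that car by (simp add: central_involutions_mod_def)
  qed
  have sub: "subgroup ?Z G"
  proof (rule subgroupI)
    show "?Z \<noteq> {}" using incl T.one_closed by blast
  qed (use mult inv in \<open>auto simp: central_involutions_mod_def\<close>)
  show "?Z \<lhd> G"
  proof (rule normal_invI[OF sub])
    fix g x assume g: "g \<in> carrier G" and x: "x \<in> ?Z"
    then have car: "x \<in> carrier G" and "comm x g \<in> T"
      by (auto simp: central_involutions_mod_def)
    then have "comm g x \<in> ?Z"
      using comm_swap_mem[OF T.subgroup_axioms] g incl by blast
    moreover have "g \<otimes> x \<otimes> inv g = comm g x \<otimes> x"
      using g car by (simp add: commutator_def word)
    ultimately show "g \<otimes> x \<otimes> inv g \<in> ?Z"
      using mult x by simp
  qed
qed

lemma central_involutions_mod_strict: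
  assumes "finite (carrier G)" "order G = 2 ^ k" "T \<lhd> G" "T \<noteq> carrier G"
  shows "T \<subset> central_involutions_mod T"
proof -
  interpret T: normal T G by fact
  interpret \<pi>: group_hom G "G Mod T" "\<lambda>x. T #> x"
    by (rule group_hom_FactGroup) fact
  obtain j where j: "order (G Mod T) = 2 ^ j"
    using order_FactGroup_two_power assms by blast
  have "T \<subset> carrier G"
    using assms(4) T.subset by (simp add: psubset_eq)
  then obtain g where "g \<in> carrier G" "g \<notin> T"
    by blast
  then have "T #> g \<in> carrier (G Mod T)" "T #> g \<noteq> \<one>\<^bsub>G Mod T\<^esub>"
    using coset_eq_one_iff[OF assms(3), of g] \<pi>.hom_closed[of g] by metis+
  then have "carrier (G Mod T) \<noteq> {\<one>\<^bsub>G Mod T\<^esub>}"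
    by (metis singletonD)
  from \<pi>.H.two_group_central_involution[OF finite_FactGroup[OF assms(1)] j this]
  obtain Z where "Z \<in> carrier (G Mod T)" and Z: "Z \<noteq> \<one>\<^bsub>G Mod T\<^esub>"
      "Z \<otimes>\<^bsub>G Mod T\<^esub> Z = \<one>\<^bsub>G Mod T\<^esub>"
      "\<forall>g \<in> carrier (G Mod T). Z \<otimes>\<^bsub>G Mod T\<^esub> g = g \<otimes>\<^bsub>G Mod T\<^esub> Z"
    by (elim bexE conjE)
  then obtain z where z: "z \<in> carrier G" "Z = T #> z"
    by (auto simp: carrier_FactGroup)
  have "z \<notin> T"
    using Z(1) z coset_eq_one_iff[OF assms(3) z(1)] by metis
  moreover have "z \<otimes> z \<in> T"
  proof -
    have "T #> (z \<otimes> z) = \<one>\<^bsub>G Mod T\<^esub>"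
      using Z(2) z \<pi>.hom_mult[OF z(1) z(1)] by simp
    then show ?thesis
      using coset_eq_one_iff[OF assms(3) m_closed[OF z(1) z(1)]] by blast
  qed
  moreover have "comm z g \<in> T" if "g \<in> carrier G" for g
  proof -
    have "T #> comm z g = commutator (G Mod T) Z (T #> g)"
      using z that by (simp add: \<pi>.hom_commutator)
    also have "\<dots> = \<one>\<^bsub>G Mod T\<^esub>"
      using z(2) \<pi>.H.comm_eq_one_iff[OF \<pi>.hom_closed[OF z(1)] \<pi>.hom_closed[OF that]]
        bspec[OF Z(3) \<pi>.hom_closed[OF that]] by metis
    finally show ?thesis
      using coset_eq_one_iff[OF assms(3) comm_closed[OF z(1) that]] by blast
  qed
  ultimately have "z \<in> central_involutions_mod T" "z \<notin> T"
    using z by (auto simp: central_involutions_mod_def)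
  then show ?thesis
    using central_involutions_mod_normal[OF assms(3)] by blast
qed

text \<open>A Frattini-type argument that replaces nilpotency: to place \<open>A\<close> inside \<open>E\<close>, one may
  compute modulo any normal \<open>T \<supseteq> E\<close> modulo which \<open>A\<close> consists of central elements of order at most 2. A
  maximal \<open>T \<supseteq> E\<close> not containing \<open>A\<close> is such a \<open>T\<close>, because the strictly larger
  subgroup of central involutions modulo \<open>T\<close> contains \<open>A\<close>.\<close>

lemma two_group_absorption:
  assumes fin: "finite (carrier G)" and ord: "order G = 2 ^ k"
    and E: "E \<lhd> G" and A: "A \<subseteq> carrier G"
    and step: "\<And>T. \<lbrakk>T \<lhd> G; E \<subseteq> T; \<And>a g. a \<in> A \<Longrightarrow> g \<in> carrier G \<Longrightarrow> comm a g \<in> T;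
      \<And>a. a \<in> A \<Longrightarrow> a \<otimes> a \<in> T\<rbrakk> \<Longrightarrow> A \<subseteq> T"
  shows "A \<subseteq> E"
proof (rule ccontr)
  assume "\<not> A \<subseteq> E"
  define \<T> where "\<T> = {T. T \<lhd> G \<and> E \<subseteq> T \<and> \<not> A \<subseteq> T}"
  have "\<T> \<subseteq> Pow (carrier G)"
    unfolding \<T>_def using normal_imp_subgroup subgroup.subset by blast
  then have "finite \<T>"
    using fin finite_subset by blast
  moreover have "E \<in> \<T>"
    using E \<open>\<not> A \<subseteq> E\<close> by (simp add: \<T>_def)
  ultimately obtain T where T: "T \<in> \<T>" and max: "\<And>S. S \<in> \<T> \<Longrightarrow> T \<subseteq> S \<Longrightarrow> T = S"
    using finite_has_maximal[of \<T>] by blast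
  then have "T \<lhd> G" "T \<noteq> carrier G"
    using A by (auto simp: \<T>_def)
  then have strict: "T \<subset> central_involutions_mod T"
    using central_involutions_mod_strict fin ord by blast
  then have "central_involutions_mod T \<notin> \<T>"
    using max by blast
  then have "A \<subseteq> central_involutions_mod T"
    using T strict central_involutions_mod_normal[OF \<open>T \<lhd> G\<close>] unfolding \<T>_def by blast
  then have "A \<subseteq> T"
    using step[of T] T unfolding \<T>_def central_involutions_mod_def by blast
  then show False
    using T by (simp add: \<T>_def)
qed

end

section \<open>The series of iterated squares\<close>

primrec square_series :: "('a, 'b) monoid_scheme \<Rightarrow> nat \<Rightarrow> 'a set"
  where "square_series G 0 = carrier G"
  | "square_series G (Suc i) = power_subgroup G (square_series G i) 2"

declare square_series.simps(2) [simp del]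

lemmas square_series_Suc = square_series.simps(2)

context group
begin

abbreviation E :: "nat \<Rightarrow> 'a set" where "E \<equiv> square_series G"

lemma pow_two: "x \<in> carrier G \<Longrightarrow> x [^] (2::nat) = x \<otimes> x"
  by (simp add: numeral_2_eq_2)

lemma pow_two_power_Suc:
  "x \<in> carrier G \<Longrightarrow> x [^] (2 ^ Suc n :: nat) = x [^] (2 ^ n :: nat) \<otimes> x [^] (2 ^ n :: nat)"
  by (simp add: nat_pow_mult mult_2)

lemma pow_two_power_add_two:
  assumes "x \<in> carrier G"
  shows "x [^] (2 ^ (n + 2) :: nat)
    = (x [^] (2 ^ n :: nat) \<otimes> x [^] (2 ^ n :: nat)) \<otimes> (x [^] (2 ^ n :: nat) \<otimes> x [^] (2 ^ n :: nat))"
  using pow_two_power_Suc[OF assms, of "Suc n"] pow_two_power_Suc[OF assms, of n]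
  by (simp only: add_2_eq_Suc')

lemma conj_nat_pow:
  assumes "x \<in> carrier G" "g \<in> carrier G"
  shows "(g \<otimes> x \<otimes> inv g) [^] (n::nat) = g \<otimes> x [^] n \<otimes> inv g"
  using assms by (induction n) (simp_all add: word)

lemma power_subgroup_normal:
  assumes "K \<lhd> G"
  shows "power_subgroup G K n \<lhd> G"
  unfolding power_subgroup_def
proof (rule normal_generateI)
  interpret K: normal K G by fact
  show "(\<lambda>x. x [^] n) ` K \<subseteq> carrier G" by auto
  fix h g assume "h \<in> (\<lambda>x. x [^] n) ` K" and g: "g \<in> carrier G"
  then obtain x where x: "x \<in> K" "h = x [^] n" by blast
  then have "g \<otimes> h \<otimes> inv g = (g \<otimes> x \<otimes> inv g) [^] n"
    using g conj_nat_pow by simp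
  moreover have "g \<otimes> x \<otimes> inv g \<in> K"
    using x g K.inv_op_closed2 by blast
  ultimately show "g \<otimes> h \<otimes> inv g \<in> (\<lambda>x. x [^] n) ` K"
    by blast
qed

lemma subgroup_nat_pow_closed:
  assumes "subgroup K G" "x \<in> K"
  shows "x [^] (n::nat) \<in> K"
  using assms by (induction n) (auto simp: subgroup.one_closed subgroup.m_closed)

lemma power_subgroup_subset:
  assumes "subgroup K G"
  shows "power_subgroup G K n \<subseteq> K"
  unfolding power_subgroup_def
  using assms subgroup_nat_pow_closed by (intro generate_subgroup_incl) auto

lemma power_subgroup_leI:
  assumes "subgroup D G" "\<And>x. x \<in> K \<Longrightarrow> x [^] n \<in> D"
  shows "power_subgroup G K n \<subseteq> D"
  unfolding power_subgroup_def using assms by (intro generate_subgroup_incl) auto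

lemma pow_mem_power_subgroup: "x \<in> K \<Longrightarrow> x [^] n \<in> power_subgroup G K n"
  unfolding power_subgroup_def by (simp add: generate.incl)

lemma square_series_normal: "E i \<lhd> G"
  by (induction i) (simp_all add: square_series_Suc power_subgroup_normal normal_invI subgroup_self)

lemma square_series_subgroup: "subgroup (E i) G"
  by (rule normal_imp_subgroup[OF square_series_normal])

lemma square_series_closed: "x \<in> E i \<Longrightarrow> x \<in> carrier G"
  by (rule subgroup.mem_carrier[OF square_series_subgroup])

lemmas square_series_one = subgroup.one_closed[OF square_series_subgroup]
lemmas square_series_mult = subgroup.m_closed[OF square_series_subgroup]
lemmas square_series_inv = subgroup.m_inv_closed[OF square_series_subgroup]
lemmas square_series_conj = normal_conj_mem[OF square_series_normal]
lemmas square_series_comm_swap = comm_swap_mem[OF square_series_subgroup]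

lemma square_series_Suc_subset: "E (Suc i) \<subseteq> E i"
  using power_subgroup_subset[OF square_series_subgroup] by (simp add: square_series_Suc)

lemma square_series_antimono:
  assumes "i \<le> j"
  shows "E j \<subseteq> E i"
  using square_series_Suc_subset assms by (rule lift_Suc_antimono_le[where f = E])

lemma square_mem_square_series: "x \<in> E i \<Longrightarrow> x \<otimes> x \<in> E (Suc i)"
  using pow_mem_power_subgroup[of x "E i" 2] 
  by (simp add: pow_two square_series_closed square_series_Suc)

lemma pow_mem_square_series: "x \<in> E i \<Longrightarrow> x [^] (2 ^ n :: nat) \<in> E (i + n)"
proof (induction n)
  case (Suc n)
  then show ?case
    using square_mem_square_series[of "x [^] (2 ^ n :: nat)" "i + n"]
      pow_two_power_Suc[OF square_series_closed, of x i n] by simp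
qed (simp add: square_series_closed)

text \<open>As \<open>E\<^sub>i\<^sub>+\<^sub>1\<close> is generated by squares, commutators with it need only be checked on squares.\<close>

lemma comm_square_series_mem:
  assumes D: "D \<lhd> G" and b: "b \<in> carrier G" and a: "a \<in> E (Suc i)"
    and gen: "\<And>x. x \<in> E i \<Longrightarrow> comm (x \<otimes> x) b \<in> D"
  shows "comm a b \<in> D"
proof (rule comm_generate_mem[OF D _ b])
  show "a \<in> generate G ((\<lambda>x. x [^] (2::nat)) ` E i)"
    using a by (simp add: power_subgroup_def square_series_Suc)
qed (use gen in \<open>auto simp: pow_two square_series_closed\<close>)

end

text \<open>The condition \<open>[G, G] \<le> E\<^sub>2\<close> is formally weaker than \<open>[G, G] \<le> G\<^sup>4\<close>, as fourth powers are squares of squares;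
  in this form it concerns the series alone and visibly passes to quotients.\<close>

locale powerful_two_group = group G for G (structure) +
  assumes finite_carrier: "finite (carrier G)"
    and order_two_power: "\<exists>k. order G = 2 ^ k"
    and comm_mem: "\<And>a b. a \<in> carrier G \<Longrightarrow> b \<in> carrier G \<Longrightarrow> commutator G a b \<in> square_series G 2"
begin

text \<open>Induction on \<open>i\<close>. For \<open>w \<in> E\<^sub>i\<close> the commutator of \<open>w\<^sup>2\<close> with \<open>g\<close> is the product of the square of
  \<open>[w, g]\<close>, which is as deep as required, and of the iterated commutator \<open>[w, [w, g]]\<close>. The latter lies in
  \<open>[E\<^sub>i\<^sub>+\<^sub>2, G]\<close>, and the absorption lemma disposes of it: if the commutators in \<open>[E\<^sub>i\<^sub>+\<^sub>1, G]\<close>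
  are central modulo \<open>T\<close>, the same computation one level higher has no error term.\<close>

lemma comm_square_series:
  assumes "v \<in> E i" "g \<in> carrier G"
  shows "comm v g \<in> E (i + 2)"
  using assms
proof (induction i arbitrary: v g)
  case 0
  then show ?case using comm_mem[of v g] by (simp add: numeral_2_eq_2)
next
  case (Suc i)
  define A where "A = {comm v g | v g. v \<in> E (Suc i) \<and> g \<in> carrier G}"
  obtain k where k: "order G = 2 ^ k" using order_two_power by blast
  have "A \<subseteq> E (i + 3)"
  proof (rule two_group_absorption[OF finite_carrier k square_series_normal])
    show "A \<subseteq> carrier G"
      by (auto simp: A_def square_series_closed)
    fix T assume T: "T \<lhd> G" and le: "E (i + 3) \<subseteq> T"
      and cen: "\<And>a g. a \<in> A \<Longrightarrow> g \<in> carrier G \<Longrightarrow> comm a g \<in> T"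
    interpret T: normal T G by fact
    have deep: "comm e w \<in> T" if e: "e \<in> E (i + 2)" and w: "w \<in> carrier G" for e w
    proof (rule comm_square_series_mem[OF T w])
      show "e \<in> E (Suc (Suc i))" using e by simp
      fix x assume x: "x \<in> E (Suc i)"
      then have car: "x \<in> carrier G" by (rule square_series_closed)
      have "comm x w \<in> A" using x w by (auto simp: A_def)
      then have "comm x (comm x w) \<in> T"
        using cen comm_swap_mem[OF T.subgroup_axioms] car w by simp
      moreover have "comm x w \<in> E (i + 2)"
        using Suc.IH x w square_series_Suc_subset by blast
      then have "comm x w \<otimes> comm x w \<in> T"
        using square_mem_square_series[of "comm x w" "i + 2"] le
        by (auto simp: numeral_2_eq_2 numeral_3_eq_3)
      ultimately show "comm (x \<otimes> x) w \<in> T"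
        using car w by (simp add: comm_square_left)
    qed
    show "A \<subseteq> T"
    proof
      fix a assume "a \<in> A"
      then obtain v g where vg: "v \<in> E (Suc i)" "g \<in> carrier G" "a = comm v g"
        by (auto simp: A_def)
      have "comm v g \<in> T"
      proof (rule comm_square_series_mem[OF T vg(2,1)])
        fix w assume w: "w \<in> E i"
        then have car: "w \<in> carrier G" by (rule square_series_closed)
        have e: "comm w g \<in> E (i + 2)" by (rule Suc.IH[OF w vg(2)])
        then have "comm w (comm w g) \<in> T"
          using deep comm_swap_mem[OF T.subgroup_axioms] car vg by simp
        moreover have "comm w g \<otimes> comm w g \<in> T"
          using square_mem_square_series[OF e] le by (auto simp: numeral_2_eq_2 numeral_3_eq_3)
        ultimately show "comm (w \<otimes> w) g \<in> T"
          using car vg by (simp add: comm_square_left)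
      qed
      then show "a \<in> T" using vg by simp
    qed
  qed
  moreover have "comm v g \<in> A"
    using Suc.prems by (auto simp: A_def)
  ultimately show ?case by (auto simp: numeral_2_eq_2 numeral_3_eq_3)
qed

text \<open>Again squaring the argument from \<open>E\<^sub>j\<close> gains one level, now with an error term that the previous
  lemma already controls.\<close>

lemma comm_square_series_square_series:
  assumes "v \<in> E i" "g \<in> E j"
  shows "comm v g \<in> E (i + j + 2)"
  using assms
proof (induction j arbitrary: v g)
  case 0
  then show ?case using comm_square_series by simp
next
  case (Suc j)
  let ?D = "E (i + Suc j + 2)"
  have v: "v \<in> carrier G" using Suc.prems square_series_closed by blast
  have "comm g v \<in> ?D"
  proof (rule comm_square_series_mem[OF square_series_normal v Suc.prems(2)])
    fix x assume x: "x \<in> E j"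
    then have car: "x \<in> carrier G" by (rule square_series_closed)
    have "comm v x \<in> E (i + j + 2)" by (rule Suc.IH[OF Suc.prems(1) x])
    then have e: "comm x v \<in> E (i + j + 2)"
      using square_series_comm_swap v car by blast
    then have "comm (comm x v) x \<in> E (i + j + 2 + 2)"
      using comm_square_series car by blast
    then have "comm x (comm x v) \<in> E (i + j + 2 + 2)"
      using square_series_comm_swap v car by simp
    then have "comm x (comm x v) \<in> ?D"
      using square_series_antimono[of "i + Suc j + 2" "i + j + 2 + 2"] by auto
    moreover have "comm x v \<otimes> comm x v \<in> ?D"
      using square_mem_square_series[OF e] by simp
    ultimately show "comm (x \<otimes> x) v \<in> ?D"
      using car v square_series_mult
      by (simp add: comm_square_left)
  qed
  then show ?case
    using square_series_comm_swap v Suc.prems square_series_closed by blast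
qed

text \<open>If \<open>E\<^sub>i\<^sub>+\<^sub>1 = E\<^sub>i\<close>, then a normal subgroup containing all squares of \<open>E\<^sub>i\<close> contains \<open>E\<^sub>i\<close>, and absorption
  makes \<open>E\<^sub>i\<close> trivial; so the series decreases strictly until it is trivial.\<close>

lemma square_series_eventually_trivial: "\<exists>n. E n = {\<one>}"
proof -
  obtain k where k: "order G = 2 ^ k" using order_two_power by blast
  have strict: "E i = {\<one>}" if eq: "E (Suc i) = E i" for i
  proof -
    have "E i \<subseteq> {\<one>}"
    proof (rule two_group_absorption[OF finite_carrier k one_is_normal])
      show "E i \<subseteq> carrier G" using square_series_closed by blast
      fix T assume T: "T \<lhd> G" and "\<And>a. a \<in> E i \<Longrightarrow> a \<otimes> a \<in> T"
      then have "E (Suc i) \<subseteq> T"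
        using power_subgroup_leI[OF normal_imp_subgroup[OF T], of "E i" 2]
        by (simp add: pow_two square_series_closed square_series_Suc)
      then show "E i \<subseteq> T" using eq by simp
    qed
    then show ?thesis
      using square_series_one by blast
  qed
  show ?thesis
  proof (rule ccontr)
    assume no: "\<nexists>n. E n = {\<one>}"
    have "card (E n) + n \<le> card (carrier G)" for n
    proof (induction n)
      case (Suc n)
      have "E (Suc n) \<subset> E n"
        using strict no square_series_Suc_subset by blast
      moreover have "finite (E n)"
        using finite_carrier finite_subset subgroup.subset[OF square_series_subgroup] by blast
      ultimately have "card (E (Suc n)) < card (E n)"
        by (rule psubset_card_mono[rotated])
      then show ?case using Suc.IH by linarith
    qed simp
    from this[of "Suc (card (carrier G))"] show False by simp
  qed
qed

text \<open>Squaring is multiplicative from \<open>E\<^sub>i\<close> to \<open>E\<^sub>i\<^sub>+\<^sub>1\<close> modulo \<open>E\<^sub>i\<^sub>+\<^sub>2\<close>, so a product of squares is a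
  square up to a deeper factor.\<close>

lemma square_series_factor:
  assumes "a \<in> E (Suc i)"
  obtains f t where "f \<in> E i" "t \<in> E (i + 2)" "a = f \<otimes> f \<otimes> t"
proof -
  let ?D = "E (i + 2)"
  note car = square_series_closed
  have "a \<in> generate G ((\<lambda>x. x [^] (2::nat)) ` E i)"
    using assms by (simp add: power_subgroup_def square_series_Suc)
  then have "\<exists>f \<in> E i. \<exists>t \<in> ?D. a = f \<otimes> f \<otimes> t"
  proof (induction rule: generate.induct)
    case one
    then show ?case
      using square_series_one by (intro bexI[of _ \<one>]) auto
  next
    case (incl h)
    then obtain f where f: "f \<in> E i" "h = f \<otimes> f" by (auto simp: pow_two car)
    then show ?case
      using square_series_one by (intro bexI[of _ f] bexI[of _ \<one>]) (auto simp: car)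
  next
    case (inv h)
    then obtain f where f: "f \<in> E i" "h = f \<otimes> f" by (auto simp: pow_two car)
    then show ?case
      using square_series_one square_series_inv
      by (intro bexI[of _ "inv f"] bexI[of _ \<one>]) (auto simp: car inv_mult_group)
  next
    case (eng h1 h2)
    then obtain f t g s where
      f: "f \<in> E i" "t \<in> ?D" "h1 = f \<otimes> f \<otimes> t" and g: "g \<in> E i" "s \<in> ?D" "h2 = g \<otimes> g \<otimes> s"
      by blast
    note c = car[OF f(1)] car[OF f(2)] car[OF g(1)] car[OF g(2)]
    let ?u = "inv (g \<otimes> g) \<otimes> (inv f \<otimes> comm f g \<otimes> f) \<otimes> (g \<otimes> g)"
    let ?r = "inv (g \<otimes> g) \<otimes> t \<otimes> (g \<otimes> g) \<otimes> s"
    have "h1 \<otimes> h2 = (f \<otimes> g) \<otimes> (f \<otimes> g) \<otimes> (?u \<otimes> ?r)"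
      unfolding f g using c by (simp add: commutator_def word)
    moreover have "comm f g \<in> ?D"
      using comm_square_series[OF f(1) c(3)] .
    then have "?u \<otimes> ?r \<in> ?D"
      using c f g by (intro square_series_mult square_series_conj) auto
    moreover have "f \<otimes> g \<in> E i"
      using f g square_series_mult by blast
    ultimately show ?case by blast
  qed
  then show thesis using that by blast
qed

text \<open>Successive approximation: the deeper factor is itself a square up to a still deeper one, and its
  root is absorbed into the root found so far. The process stops because the series reaches the
  trivial group.\<close>

lemma square_root:
  assumes a: "a \<in> E (Suc i)"
  obtains h where "h \<in> E i" "a = h \<otimes> h"
proof -
  have approx: "\<exists>h \<in> E i. \<exists>t \<in> E (Suc i + k). a = h \<otimes> h \<otimes> t" for k
  proof (induction k)
    case 0
    show ?case
      using a square_series_one square_series_closed[OF a]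
      by (intro bexI[of _ \<one>] bexI[of _ a]) auto
  next
    case (Suc k)
    let ?D = "E (Suc i + Suc k)"
    obtain h t where h: "h \<in> E i" "t \<in> E (Suc (i + k))" "a = h \<otimes> h \<otimes> t"
      using Suc.IH by auto
    obtain f s where f: "f \<in> E (i + k)" "s \<in> E (i + k + 2)" "t = f \<otimes> f \<otimes> s"
      using square_series_factor[OF h(2)] by blast
    have c: "h \<in> carrier G" "f \<in> carrier G" "s \<in> carrier G"
      using h f square_series_closed by blast+
    let ?r = "inv (f \<otimes> f) \<otimes> (inv h \<otimes> comm h f \<otimes> h) \<otimes> (f \<otimes> f)"
    have "a = (h \<otimes> f) \<otimes> (h \<otimes> f) \<otimes> (?r \<otimes> s)"
      unfolding h f using c by (simp add: commutator_def word)
    moreover have "comm f h \<in> E (i + k + 2)"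
      using comm_square_series f c by blast
    then have "comm h f \<in> ?D"
      using square_series_comm_swap c by simp
    then have "?r \<otimes> s \<in> ?D"
      using f(2) c by (intro square_series_mult square_series_conj) auto
    moreover have "f \<in> E i"
      using f(1) square_series_antimono[of i "i + k"] by auto
    then have "h \<otimes> f \<in> E i"
      using h(1) square_series_mult by blast
    ultimately show ?case by blast
  qed
  obtain n where n: "E n = {\<one>}"
    using square_series_eventually_trivial by blast
  obtain h t where h: "h \<in> E i" "t \<in> E (Suc i + n)" "a = h \<otimes> h \<otimes> t"
    using approx by blast
  moreover have "t = \<one>"
    using h(2) n square_series_antimono[of n "Suc i + n"] by auto
  ultimately show thesis
    using that square_series_closed by auto
qed

lemma square_series_eq_powers: "E i = {g [^] (2 ^ i :: nat) | g. g \<in> carrier G}"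
proof
  have "\<exists>g \<in> E j. a = g [^] (2 ^ i :: nat)" if "a \<in> E (i + j)" for a j
    using that
  proof (induction i arbitrary: a j)
    case 0
    then show ?case using square_series_closed by auto
  next
    case (Suc i)
    then obtain h where h: "h \<in> E (i + j)" "a = h \<otimes> h"
      using square_root[of a "i + j"] by auto
    then show ?case
      using Suc.IH pow_two_power_Suc square_series_closed by metis
  qed
  from this[of _ 0] show "E i \<subseteq> {g [^] (2 ^ i :: nat) | g. g \<in> carrier G}" by auto
  show "{g [^] (2 ^ i :: nat) | g. g \<in> carrier G} \<subseteq> E i"
    using pow_mem_square_series[of _ 0 i] by auto
qed

end

section \<open>Commuting powers of elements of bounded order\<close>

text \<open>The statement on orders for \<open>G/D\<close>, phrased with elements of \<open>G\<close> so that one induction can range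
  over all quotients of \<open>G\<close>. The orders may differ by a factor of 2: the induction needs the larger
  bound on \<open>x\<close> for roots of involutions.\<close>

definition commuting_powers :: "('a, 'b) monoid_scheme \<Rightarrow> 'a set \<Rightarrow> nat \<Rightarrow> bool"
  where "commuting_powers G D s \<longleftrightarrow>
    (\<forall>x \<in> carrier G. \<forall>y \<in> carrier G. \<forall>a b. a + b = s \<longrightarrow>
      x [^]\<^bsub>G\<^esub> (2 ^ Suc s :: nat) \<in> D \<longrightarrow> y [^]\<^bsub>G\<^esub> (2 ^ s :: nat) \<in> D \<longrightarrow>
      commutator G (x [^]\<^bsub>G\<^esub> (2 ^ a :: nat)) (y [^]\<^bsub>G\<^esub> (2 ^ b :: nat)) \<in> D)"

context group
begin

lemma commuting_powersD:
  assumes "commuting_powers G D (a + b)" "x \<in> carrier G" "y \<in> carrier G"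
    "x [^] (2 ^ Suc (a + b) :: nat) \<in> D" "y [^] (2 ^ (a + b) :: nat) \<in> D"
  shows "comm (x [^] (2 ^ a :: nat)) (y [^] (2 ^ b :: nat)) \<in> D"
  using assms unfolding commuting_powers_def by blast

lemma pow_two_power_subgroup_mono:
  assumes "subgroup D G" "x \<in> carrier G" "x [^] (2 ^ m :: nat) \<in> D" "m \<le> n"
  shows "x [^] (2 ^ n :: nat) \<in> D"
proof -
  have "x [^] (2 ^ n :: nat) = (x [^] (2 ^ m :: nat)) [^] (2 ^ (n - m) :: nat)"
    using assms(2,4) by (simp add: nat_pow_pow power_add [symmetric])
  then show ?thesis
    using subgroup_nat_pow_closed[OF assms(1,3)] by simp
qed

lemma pow_two_power_eq_one_mono:
  assumes "x \<in> carrier G" "x [^] (2 ^ m :: nat) = \<one>" "m \<le> n"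
  shows "x [^] (2 ^ n :: nat) = \<one>"
  using pow_two_power_subgroup_mono[OF triv_subgroup assms(1) _ assms(3)] assms(2) by simp

lemma commuting_powers_commute:
  assumes "commuting_powers G {\<one>} (a + b)" "x \<in> carrier G" "y \<in> carrier G"
    "x [^] (2 ^ m :: nat) = \<one>" "m \<le> Suc (a + b)" "y [^] (2 ^ n :: nat) = \<one>" "n \<le> a + b"
  shows "x [^] (2 ^ a :: nat) \<otimes> y [^] (2 ^ b :: nat) = y [^] (2 ^ b :: nat) \<otimes> x [^] (2 ^ a :: nat)"
proof -
  have "comm (x [^] (2 ^ a :: nat)) (y [^] (2 ^ b :: nat)) = \<one>"
    using commuting_powersD[OF assms(1-3)] pow_two_power_eq_one_mono[OF assms(2,4,5)]
      pow_two_power_eq_one_mono[OF assms(3,6,7)] by simp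
  then show ?thesis
    using comm_eq_one_iff assms(2,3) by simp
qed

end

context powerful_two_group
begin

lemma two_power_root:
  assumes "a \<in> E i"
  obtains g where "g \<in> carrier G" "a = g [^] (2 ^ i :: nat)"
  using assms square_series_eq_powers by blast

text \<open>An infinite descent. Let the involution \<open>y\<close> invert an element \<open>t \<in> E\<^sub>j\<close> of order 4. Then \<open>t\<^sup>2 = [t, y]\<close> is two levels
  deeper than \<open>t\<close>, so it has a square root \<open>u\<close> one level deeper than \<open>t\<close>, which commutes with \<open>t\<close>.
  The quotient \<open>z = t u\<^sup>-\<^sup>1\<close> is an element of \<open>E\<^sub>j\<close> of order at most 2 and therefore commutes with \<open>y\<close>; hence \<open>y\<close> also inverts
  \<open>u\<close>, and \<open>u\<close> has order 4 as well.\<close>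

lemma inverted_element_is_involution:
  assumes above: "\<And>r. s < r \<Longrightarrow> commuting_powers G {\<one>} r" and "0 < s"
    and y: "y \<in> carrier G" "y \<otimes> y = \<one>"
    and "s < j" "t \<in> E j" "(t \<otimes> t) \<otimes> (t \<otimes> t) = \<one>" "y \<otimes> t \<otimes> inv y = inv t"
  shows "t \<otimes> t = \<one>"
proof -
  obtain n where n: "E n = {\<one>}"
    using square_series_eventually_trivial by blast
  show ?thesis
    using assms(5-8)
  proof (induction "n - j" arbitrary: j t)
    case 0
    then have "t \<in> E n" using square_series_antimono[of n j] by auto
    then show ?case using n by simp
  next
    case (Suc m)
    have t: "t \<in> carrier G" using Suc.prems square_series_closed by blast
    have "comm t y = t \<otimes> inv (y \<otimes> t \<otimes> inv y)"
      using t y by (simp add: commutator_def word)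
    then have "comm t y = t \<otimes> t"
      using Suc.prems t by simp
    then have "t \<otimes> t \<in> E (j + 2)"
      using comm_square_series[OF Suc.prems(2) y(1)] by simp
    then obtain r where r: "r \<in> carrier G" "t \<otimes> t = r [^] (2 ^ (j + 2) :: nat)"
      by (rule two_power_root)
    obtain w where w: "w \<in> carrier G" "t = w [^] (2 ^ j :: nat)"
      using Suc.prems(2) by (rule two_power_root)
    define u where "u = r [^] (2 ^ (j + 1) :: nat)"
    have u: "u \<in> carrier G" "u \<otimes> u = t \<otimes> t"
      using r pow_two_power_Suc[OF r(1), of "j + 1"] by (simp_all add: u_def)
    have u_deep: "u \<in> E (j + 1)"
      using pow_mem_square_series[of r 0 "j + 1"] r by (simp add: u_def)
    have "w [^] (2 ^ (j + 2) :: nat) = \<one>"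
      using Suc.prems(3) w pow_two_power_add_two[OF w(1)] by simp
    moreover have "r [^] (2 ^ (j + 3) :: nat) = \<one>"
      using Suc.prems(3) r pow_two_power_Suc[OF r(1), of "j + 2"] by (simp add: numeral_eq_Suc)
    \<comment> \<open>At level \<open>2 j + 1\<close> the admissible orders \<open>2\<^sup>2\<^sup>j\<^sup>+\<^sup>2\<close> and \<open>2\<^sup>2\<^sup>j\<^sup>+\<^sup>1\<close> are at least the
      orders \<open>2\<^sup>j\<^sup>+\<^sup>3\<close> of \<open>r\<close> and \<open>2\<^sup>j\<^sup>+\<^sup>2\<close> of \<open>w\<close>.\<close>
    ultimately have ut: "u \<otimes> t = t \<otimes> u"
      unfolding u_def w(2) using above[of "j + 1 + j"] r w \<open>0 < s\<close> \<open>s < j\<close>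
      by (intro commuting_powers_commute[where m = "j + 3" and n = "j + 2"]) auto
    define z where "z = t \<otimes> inv u"
    have z: "z \<in> carrier G" using t u by (simp add: z_def)
    have tz: "t = z \<otimes> u" using t u by (simp add: z_def word)
    have tu: "t \<otimes> inv u = inv u \<otimes> t"
      using ut t u by (metis inv_closed inv_solve_left inv_solve_right m_assoc m_closed)
    have "z \<otimes> z = (t \<otimes> t) \<otimes> inv (u \<otimes> u)"
      unfolding z_def using t u tu by (metis inv_closed inv_mult_group m_assoc m_closed)
    then have zz: "z \<otimes> z = \<one>" using u t by simp
    have "z \<in> E j"
      unfolding z_def using Suc.prems(2) u_deep square_series_antimono[of j "j + 1"]
      by (intro square_series_mult square_series_inv) auto
    then obtain v where v: "v \<in> carrier G" "z = v [^] (2 ^ j :: nat)"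
      by (rule two_power_root)
    have "v [^] (2 ^ Suc j :: nat) = \<one>"
      using zz v pow_two_power_Suc[OF v(1), of j] by simp
    moreover have "y [^] (2 ^ 1 :: nat) = \<one>"
      using y by (simp add: pow_two)
    ultimately have "v [^] (2 ^ j :: nat) \<otimes> y [^] (2 ^ 0 :: nat) = y [^] (2 ^ 0 :: nat) \<otimes> v [^] (2 ^ j :: nat)"
      using above[of "j + 0"] v y \<open>s < j\<close>
      by (intro commuting_powers_commute[where m = "Suc j" and n = 1]) auto
    then have zy: "z \<otimes> y = y \<otimes> z"
      using v y by simp
    have inv_z: "inv z = z"
      using zz z by (metis inv_equality)
    have uz: "u = z \<otimes> t"
      using tz inv_z z u by (metis cancel_inv(1))
    have zt: "z \<otimes> t = t \<otimes> z"
      using t u tu ut z unfolding z_def by (metis inv_closed m_assoc)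
    have "y \<otimes> u \<otimes> inv y = z \<otimes> (y \<otimes> t \<otimes> inv y)"
      unfolding uz using zy z t y by (metis inv_closed m_assoc m_closed)
    also have "\<dots> = inv z \<otimes> inv t"
      using Suc.prems inv_z by simp
    also have "\<dots> = inv u"
      unfolding uz zt using z t by (simp add: inv_mult_group)
    finally have "y \<otimes> u \<otimes> inv y = inv u" .
    moreover have "m = n - (j + 1)" using Suc.hyps(2) by simp
    moreover have "s < j + 1" using Suc.prems(1) by simp
    moreover have "(u \<otimes> u) \<otimes> (u \<otimes> u) = \<one>"
      using Suc.prems(3) u(2) by simp
    ultimately have "u \<otimes> u = \<one>"
      using Suc.hyps(1)[of "j + 1" u] u_deep by blast
    then show ?case using u(2) by simp
  qed
qed

text \<open>Put \<open>e = [x, y]\<close>. The conjugate \<open>e y\<close> of the involution \<open>y\<close> is an involution, so \<open>y\<close> inverts \<open>e\<close>. By the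
  descent \<open>e\<close> has order at most 2, and being deep it commutes with \<open>x\<close>. Hence \<open>[x\<^sup>2, y] = e\<^sup>2 = 1\<close>.\<close>

lemma square_commutes_with_involution:
  assumes above: "\<And>r. s < r \<Longrightarrow> commuting_powers G {\<one>} r" and s: "0 < s"
    and y: "y \<in> E (s - 1)" "y \<otimes> y = \<one>"
    and x: "x \<in> carrier G" "(x \<otimes> x) \<otimes> (x \<otimes> x) = \<one>"
  shows "(x \<otimes> x) \<otimes> y = y \<otimes> (x \<otimes> x)"
proof -
  have yc: "y \<in> carrier G" using y square_series_closed by blast
  define e where "e = comm x y"
  have e: "e \<in> carrier G" using x yc by (simp add: e_def)
  have "comm y x \<in> E (s + 1)"
    using comm_square_series[OF y(1) x(1)] s by simp
  then have e_deep: "e \<in> E (s + 1)"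
    using square_series_comm_swap[OF yc x(1)] by (simp add: e_def)
  have "e \<otimes> y = x \<otimes> y \<otimes> inv x"
    using x yc by (simp add: e_def commutator_def word)
  then have "(e \<otimes> y) \<otimes> (e \<otimes> y) = x \<otimes> (y \<otimes> y) \<otimes> inv x"
    using x yc by (simp add: word)
  then have "(e \<otimes> y) \<otimes> (e \<otimes> y) = \<one>"
    using x y by simp
  moreover have inv_y: "inv y = y"
    using y yc by (metis inv_equality)
  ultimately have "e \<otimes> (y \<otimes> e \<otimes> inv y) = \<one>"
    using e yc by (simp add: m_assoc)
  then have inverted: "y \<otimes> e \<otimes> inv y = inv e"
    using e yc by (metis inv_equality inv_closed inv_inv m_closed)
  have small: "e [^] (2 ^ Suc m :: nat) = \<one> \<Longrightarrow> e \<otimes> e = \<one>" for m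
  proof (induction m)
    case 0
    then show ?case using e by (simp add: pow_two)
  next
    case (Suc m)
    define t where "t = e [^] (2 ^ m :: nat)"
    have tt: "t \<otimes> t = e [^] (2 ^ Suc m :: nat)"
      using pow_two_power_Suc[OF e] by (simp add: t_def)
    have "t \<otimes> t = \<one>"
    proof (rule inverted_element_is_involution[OF above s yc y(2)])
      show "t \<in> E (s + 1)"
        using e_deep subgroup_nat_pow_closed[OF square_series_subgroup] by (simp add: t_def)
      show "(t \<otimes> t) \<otimes> (t \<otimes> t) = \<one>"
        unfolding tt using pow_two_power_Suc[OF e, of "Suc m"] Suc.prems by simp
      show "y \<otimes> t \<otimes> inv y = inv t"
        using conj_nat_pow[OF e yc] inverted e by (simp add: t_def nat_pow_inv)
    qed simp_all
    then show ?case using Suc.IH tt by simp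
  qed
  obtain k where k: "order G = 2 ^ k" using order_two_power by blast
  have "e [^] (2 ^ k :: nat) = \<one>"
    using pow_order_eq_1[OF e] k by simp
  then have ee: "e \<otimes> e = \<one>"
    using small[of k] pow_two_power_eq_one_mono[OF e, of k "Suc k"] by simp
  obtain v where v: "v \<in> carrier G" "e = v [^] (2 ^ (s + 1) :: nat)"
    using e_deep by (rule two_power_root)
  have "v [^] (2 ^ (s + 2) :: nat) = \<one>"
    using ee v pow_two_power_Suc[OF v(1), of "s + 1"] by simp
  moreover have "x [^] (2 ^ 2 :: nat) = \<one>"
    using x pow_two_power_Suc[OF x(1), of 1] by (simp add: pow_two numeral_2_eq_2)
  ultimately have "v [^] (2 ^ (s + 1) :: nat) \<otimes> x [^] (2 ^ 0 :: nat)
      = x [^] (2 ^ 0 :: nat) \<otimes> v [^] (2 ^ (s + 1) :: nat)"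
    using above[of "s + 1 + 0"] v x s
    by (intro commuting_powers_commute[where m = "s + 2" and n = 2]) auto
  then have "x \<otimes> e = e \<otimes> x"
    using v x by simp
  then have "comm x e = \<one>"
    using comm_eq_one_iff x e by simp
  then have "comm (x \<otimes> x) y = \<one>"
    using comm_square_left[OF x(1) yc] ee by (simp add: e_def)
  then show ?thesis
    using comm_eq_one_iff x yc by simp
qed

definition deep_involutions :: "nat \<Rightarrow> 'a set"
  where "deep_involutions i = {a \<in> E i. a \<otimes> a = \<one>}"

text \<open>Two involutions of \<open>E\<^sub>s\<^sub>-\<^sub>1\<close> commute, because one of them is the square of an element of order
  dividing 4. This is where \<open>s \<ge> 2\<close> enters: for \<open>s = 1\<close> an involution need not be a square.\<close>

lemma deep_involutions_normal:
  assumes above: "\<And>r. s < r \<Longrightarrow> commuting_powers G {\<one>} r" and s: "2 \<le> s"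
  shows "deep_involutions (s - 1) \<lhd> G"
proof -
  let ?\<Omega> = "deep_involutions (s - 1)"
  have car: "a \<in> carrier G" if "a \<in> ?\<Omega>" for a
    using that square_series_closed by (auto simp: deep_involutions_def)
  have commute: "a \<otimes> b = b \<otimes> a" if a: "a \<in> ?\<Omega>" and b: "b \<in> ?\<Omega>" for a b
  proof -
    have "a \<in> E (Suc (s - 2))"
      using a s by (simp add: deep_involutions_def Suc_diff_Suc numeral_2_eq_2)
    then obtain h where h: "h \<in> E (s - 2)" "a = h \<otimes> h"
      by (rule square_root)
    have "(h \<otimes> h) \<otimes> b = b \<otimes> (h \<otimes> h)"
    proof (rule square_commutes_with_involution[OF above])
      show "b \<in> E (s - 1)" "b \<otimes> b = \<one>" "(h \<otimes> h) \<otimes> (h \<otimes> h) = \<one>"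
        using a b h by (auto simp: deep_involutions_def)
    qed (use s h square_series_closed in auto)
    then show ?thesis using h by simp
  qed
  have sub: "subgroup ?\<Omega> G"
  proof (rule subgroupI)
    show "?\<Omega> \<subseteq> carrier G" using car by blast
    have "\<one> \<in> ?\<Omega>" by (simp add: deep_involutions_def square_series_one)
    then show "?\<Omega> \<noteq> {}" by blast
    show "inv a \<in> ?\<Omega>" if a: "a \<in> ?\<Omega>" for a
    proof -
      have "inv a = a"
        using a car[OF a] inv_equality[of a a] by (simp add: deep_involutions_def)
      then show ?thesis using a by simp
    qed
    show "a \<otimes> b \<in> ?\<Omega>" if a: "a \<in> ?\<Omega>" and b: "b \<in> ?\<Omega>" for a b
    proof -
      have "(a \<otimes> b) \<otimes> (a \<otimes> b) = (a \<otimes> a) \<otimes> (b \<otimes> b)"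
        using commute[OF a b] car[OF a] car[OF b] by (metis m_assoc m_closed)
      then show ?thesis
        using a b square_series_mult by (simp add: deep_involutions_def)
    qed
  qed
  show ?thesis
  proof (rule normal_invI[OF sub])
    fix g a assume g: "g \<in> carrier G" and a: "a \<in> ?\<Omega>"
    have "(g \<otimes> a \<otimes> inv g) \<otimes> (g \<otimes> a \<otimes> inv g) = g \<otimes> (a \<otimes> a) \<otimes> inv g"
      using g car[OF a] by (simp add: word)
    then show "g \<otimes> a \<otimes> inv g \<in> ?\<Omega>"
      using a g square_series_conj by (simp add: deep_involutions_def)
  qed
qed

lemma deep_involutions_trivial_imp:
  assumes "deep_involutions i = {\<one>}"
  shows "E i = {\<one>}"
proof -
  have "g = \<one>" if "g \<in> E i" "g [^] (2 ^ k :: nat) = \<one>" for g k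
    using that
  proof (induction k arbitrary: g)
    case 0
    then show ?case using square_series_closed by simp
  next
    case (Suc k)
    then have g: "g \<in> carrier G" using square_series_closed by blast
    have "(g \<otimes> g) [^] (2 ^ k :: nat) = g [^] (2 ^ Suc k :: nat)"
      using g by (simp add: pow_two [symmetric] nat_pow_pow)
    then have "g \<otimes> g = \<one>"
      using Suc square_series_mult by simp
    then show ?case
      using assms Suc.prems by (auto simp: deep_involutions_def)
  qed
  moreover obtain k where "order G = 2 ^ k" using order_two_power by blast
  ultimately have "g = \<one>" if "g \<in> E i" for g
    using that pow_order_eq_1 square_series_closed by metis
  then show ?thesis
    using square_series_one by blast
qed

text \<open>For \<open>a > 0\<close> and \<open>s \<ge> 2\<close> the case \<open>s - 1\<close> modulo the involutions \<open>\<Omega>\<close> of \<open>E\<^sub>s\<^sub>-\<^sub>1\<close> shows that the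
  commutator \<open>w\<close> taken with \<open>a - 1\<close> in place of \<open>a\<close> is an involution or trivial. It lies in \<open>E\<^sub>s\<^sub>+\<^sub>1\<close>, so the
  case \<open>s + 1\<close>, applied to a root of \<open>w\<close>, shows that it commutes with \<open>x\<close>; squaring the
  first argument then squares \<open>w\<close> and gives 1. If \<open>\<Omega>\<close> is trivial, then so is \<open>E\<^sub>s\<^sub>-\<^sub>1\<close>, which
  contains the commutator.\<close>

lemma commuting_powers_step:
  assumes above: "\<And>r. s < r \<Longrightarrow> commuting_powers G {\<one>} r"
    and quot: "\<And>\<Omega> r. \<Omega> \<lhd> G \<Longrightarrow> \<Omega> \<noteq> {\<one>} \<Longrightarrow> commuting_powers G \<Omega> r"
  shows "commuting_powers G {\<one>} s"
  unfolding commuting_powers_def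
proof (intro ballI allI impI)
  fix x y and a b :: nat
  assume x: "x \<in> carrier G" and y: "y \<in> carrier G" and ab: "a + b = s"
    and "x [^] (2 ^ Suc s :: nat) \<in> {\<one>}" and "y [^] (2 ^ s :: nat) \<in> {\<one>}"
  then have x1: "x [^] (2 ^ Suc s :: nat) = \<one>" and y1: "y [^] (2 ^ s :: nat) = \<one>" by simp_all
  let ?p = "x [^] (2 ^ a :: nat)" and ?q = "y [^] (2 ^ b :: nat)"
  consider "a = 0" | "s = 1" "a = 1" "b = 0" | "2 \<le> s" "0 < a"
    using ab by linarith
  then have "comm ?p ?q = \<one>"
  proof cases
    case 1
    then show ?thesis
      using ab y1 x by (simp add: comm_eq_one_iff)
  next
    case 2
    have "(x \<otimes> x) \<otimes> y = y \<otimes> (x \<otimes> x)"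
    proof (rule square_commutes_with_involution[OF above])
      show "y \<otimes> y = \<one>" using y1 2 y by (simp add: pow_two)
      show "(x \<otimes> x) \<otimes> (x \<otimes> x) = \<one>"
        using x1 2 x pow_two_power_Suc[OF x, of 1] by (simp add: pow_two)
    qed (use 2 x y in auto)
    then show ?thesis
      using 2 x y by (simp add: pow_two comm_eq_one_iff)
  next
    case 3
    show ?thesis
    proof (cases "deep_involutions (s - 1) = {\<one>}")
      case True
      have "?p \<in> E a" "?q \<in> E b"
        using pow_mem_square_series[of _ 0] x y by simp_all
      then have "comm ?p ?q \<in> E (a + b + 2)"
        by (rule comm_square_series_square_series)
      then have "comm ?p ?q \<in> E (s - 1)"
        using square_series_antimono[of "s - 1" "a + b + 2"] ab
        by (meson diff_le_self le_add1 order_trans subsetD)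
      then show ?thesis
        using deep_involutions_trivial_imp[OF True] by simp
    next
      case False
      let ?\<Omega> = "deep_involutions (s - 1)"
      obtain c where c: "a = Suc c" using \<open>0 < a\<close> gr0_implies_Suc by blast
      then have s: "s - 1 = c + b" "s = Suc (c + b)" using ab by simp_all
      let ?h = "x [^] (2 ^ c :: nat)"
      have "commuting_powers G ?\<Omega> (c + b)"
        using quot[OF deep_involutions_normal[OF above] False] 3 s by simp
      moreover have "x [^] (2 ^ Suc (c + b) :: nat) \<in> ?\<Omega>"
        using pow_mem_square_series[of x 0 s] square_series_antimono[of "s - 1" s] x x1
          pow_two_power_Suc[OF x, of s] s
        by (auto simp: deep_involutions_def)
      moreover have "y [^] (2 ^ (c + b) :: nat) \<in> ?\<Omega>"
        using pow_mem_square_series[of y 0 "s - 1"] y y1 pow_two_power_Suc[OF y, of "c + b"] s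
        by (auto simp: deep_involutions_def)
      ultimately have "comm ?h ?q \<in> ?\<Omega>"
        using commuting_powersD x y by blast
      define w where "w = comm ?h ?q"
      have w: "w \<in> carrier G" "w \<otimes> w = \<one>"
        using \<open>comm ?h ?q \<in> ?\<Omega>\<close> x y by (simp_all add: deep_involutions_def w_def)
      have "?h \<in> E c" "?q \<in> E b"
        using pow_mem_square_series[of _ 0] x y by simp_all
      then have "w \<in> E (c + b + 2)"
        unfolding w_def by (rule comm_square_series_square_series)
      then have "w \<in> E (s + 1)" using s by simp
      then obtain v where v: "v \<in> carrier G" "w = v [^] (2 ^ (s + 1) :: nat)"
        by (rule two_power_root)
      have "v [^] (2 ^ (s + 2) :: nat) = \<one>"
        using w v pow_two_power_Suc[OF v(1), of "s + 1"] by simp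
      then have "v [^] (2 ^ (s + 1) :: nat) \<otimes> x [^] (2 ^ 0 :: nat)
          = x [^] (2 ^ 0 :: nat) \<otimes> v [^] (2 ^ (s + 1) :: nat)"
        using above[of "s + 1 + 0"] v x x1
        by (intro commuting_powers_commute[where m = "s + 2" and n = "Suc s"]) auto
      then have "x \<otimes> w = w \<otimes> x"
        using v x by simp
      then have "?h \<otimes> w = w \<otimes> ?h"
        using group_commutes_pow x w by simp
      then have "comm ?h w = \<one>"
        using comm_eq_one_iff x w by simp
      moreover have "?p = ?h \<otimes> ?h"
        using pow_two_power_Suc[OF x] c by simp
      ultimately show ?thesis
        using comm_square_left[of ?h ?q] x y w by (simp add: w_def)
    qed
  qed
  then show "comm ?p ?q \<in> {\<one>}" by simp
qed

lemma commuting_powers_trivial: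
  assumes quot: "\<And>\<Omega> r. \<Omega> \<lhd> G \<Longrightarrow> \<Omega> \<noteq> {\<one>} \<Longrightarrow> commuting_powers G \<Omega> r"
  shows "commuting_powers G {\<one>} s"
proof -
  obtain n where n: "E n = {\<one>}"
    using square_series_eventually_trivial by blast
  show ?thesis
  proof (induction "n - s" arbitrary: s rule: less_induct)
    case less
    show ?case
    proof (cases "s < n")
      case True
      show ?thesis
      proof (rule commuting_powers_step[OF _ quot])
        fix r assume "s < r"
        then show "commuting_powers G {\<one>} r"
          using less True by (simp add: diff_less_mono2)
      qed
    next
      case False
      show ?thesis
        unfolding commuting_powers_def
      proof (intro ballI allI impI)
        fix x y and a b :: nat
        assume x: "x \<in> carrier G" and y: "y \<in> carrier G" and ab: "a + b = s"
        have "x [^] (2 ^ a :: nat) \<in> E a" "y [^] (2 ^ b :: nat) \<in> E b"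
          using pow_mem_square_series[of _ 0] x y by simp_all
        then have "comm (x [^] (2 ^ a :: nat)) (y [^] (2 ^ b :: nat)) \<in> E (a + b + 2)"
          by (rule comm_square_series_square_series)
        then show "comm (x [^] (2 ^ a :: nat)) (y [^] (2 ^ b :: nat)) \<in> {\<one>}"
          using square_series_antimono[of n "a + b + 2"] ab False n by auto
      qed
    qed
  qed
qed

lemma powerful_FactGroup:
  assumes "D \<lhd> G"
  shows "powerful_two_group (G Mod D)"
proof -
  interpret \<pi>: group_hom G "G Mod D" "\<lambda>x. D #> x"
    by (rule group_hom_FactGroup) fact
  obtain k where k: "order G = 2 ^ k" using order_two_power by blast
  show ?thesis
  proof unfold_locales
    show "finite (carrier (G Mod D))" by (rule finite_FactGroup[OF finite_carrier])
    show "\<exists>k. order (G Mod D) = 2 ^ k"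
      using order_FactGroup_two_power[OF assms k] .
    fix U V assume "U \<in> carrier (G Mod D)" "V \<in> carrier (G Mod D)"
    then obtain x y where xy: "x \<in> carrier G" "y \<in> carrier G" "U = D #> x" "V = D #> y"
      by (auto simp: carrier_FactGroup)
    obtain g where g: "g \<in> carrier G" "comm x y = g [^] (2 ^ 2 :: nat)"
      using comm_mem[OF xy(1,2)] by (rule two_power_root)
    then have "commutator (G Mod D) U V = (D #> g) [^]\<^bsub>G Mod D\<^esub> (2 ^ 2 :: nat)"
      using xy \<pi>.hom_commutator \<pi>.hom_nat_pow by metis
    moreover have "(D #> g) [^]\<^bsub>G Mod D\<^esub> (2 ^ 2 :: nat) \<in> square_series (G Mod D) (0 + 2)"
      using g by (intro \<pi>.H.pow_mem_square_series) simp
    ultimately show "commutator (G Mod D) U V \<in> square_series (G Mod D) 2"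
      by (simp only: add_0)
  qed
qed

text \<open>Downward induction on the size of \<open>D\<close>: nontrivial normal subgroups of \<open>G/D\<close> correspond to larger normal
  subgroups of \<open>G\<close>.\<close>

lemma commuting_powers_normal:
  assumes "D \<lhd> G"
  shows "commuting_powers G D s"
  using assms
proof (induction "card (carrier G) - card D" arbitrary: D s rule: less_induct)
  case (less D s)
  interpret D: normal D G by fact
  interpret \<pi>: group_hom G "G Mod D" "\<lambda>x. D #> x"
    by (rule group_hom_FactGroup) fact
  interpret Q: powerful_two_group "G Mod D"
    by (rule powerful_FactGroup) fact
  have cp: "commuting_powers (G Mod D) {\<one>\<^bsub>G Mod D\<^esub>} s"
  proof (rule Q.commuting_powers_trivial)
    fix \<Omega> and r :: nat assume \<Omega>: "\<Omega> \<lhd> G Mod D" "\<Omega> \<noteq> {\<one>\<^bsub>G Mod D\<^esub>}"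
    interpret \<Omega>: normal \<Omega> "G Mod D" by fact
    define D' where "D' = {x \<in> carrier G. D #> x \<in> \<Omega>}"
    have sub: "subgroup D' G"
    proof (rule subgroupI)
      have "\<one> \<in> D'" using \<Omega>.one_closed \<pi>.hom_one by (simp add: D'_def del: one_FactGroup)
      then show "D' \<noteq> {}" by blast
    qed (auto simp: D'_def \<pi>.hom_inv \<Omega>.m_inv_closed simp del: one_FactGroup mult_FactGroup)
    have normal: "D' \<lhd> G"
      by (rule normal_invI[OF sub])
        (auto simp: D'_def \<Omega>.inv_op_closed2 simp del: one_FactGroup mult_FactGroup)
    have incl: "D \<subseteq> D'"
    proof
      fix d assume "d \<in> D"
      then have "D #> d = \<one>\<^bsub>G Mod D\<^esub>"
        using coset_eq_one_iff[OF less.prems D.mem_carrier] by blast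
      then show "d \<in> D'"
        using \<Omega>.one_closed \<open>d \<in> D\<close> by (simp add: D'_def)
    qed
    obtain U where U: "U \<in> \<Omega>" "U \<noteq> \<one>\<^bsub>G Mod D\<^esub>"
      using \<Omega>(2) \<Omega>.one_closed by blast
    then have "U \<in> carrier (G Mod D)" by (intro \<Omega>.mem_carrier)
    then obtain x where x: "x \<in> carrier G" "U = D #> x"
      by (auto simp: carrier_FactGroup)
    then have "x \<in> D'" "x \<notin> D"
      using U coset_eq_one_iff[OF less.prems x(1)] by (simp_all add: D'_def)
    then have "D \<subset> D'" using incl by blast
    moreover have "D' \<subseteq> carrier G" by (auto simp: D'_def)
    moreover have "finite D'" using finite_carrier \<open>D' \<subseteq> carrier G\<close> finite_subset by blast
    ultimately have "card D < card D'" "card D' \<le> card (carrier G)"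
      using psubset_card_mono card_mono finite_carrier by blast+
    then have cp': "commuting_powers G D' r"
      by (intro less.hyps normal) linarith
    show "commuting_powers (G Mod D) \<Omega> r"
      unfolding commuting_powers_def
    proof (intro ballI allI impI)
      fix U V and a b :: nat
      assume "U \<in> carrier (G Mod D)" "V \<in> carrier (G Mod D)" and ab: "a + b = r"
        and UV: "U [^]\<^bsub>G Mod D\<^esub> (2 ^ Suc r :: nat) \<in> \<Omega>" "V [^]\<^bsub>G Mod D\<^esub> (2 ^ r :: nat) \<in> \<Omega>"
      then obtain x y where xy: "x \<in> carrier G" "y \<in> carrier G" "U = D #> x" "V = D #> y"
        by (auto simp: carrier_FactGroup)
      have "x [^] (2 ^ Suc (a + b) :: nat) \<in> D'" "y [^] (2 ^ (a + b) :: nat) \<in> D'"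
        using UV xy ab unfolding D'_def by (simp_all add: D.FactGroup_pow)
      then have "comm (x [^] (2 ^ a :: nat)) (y [^] (2 ^ b :: nat)) \<in> D'"
        using commuting_powersD cp' ab xy by blast
      then show "commutator (G Mod D) (U [^]\<^bsub>G Mod D\<^esub> (2 ^ a :: nat)) (V [^]\<^bsub>G Mod D\<^esub> (2 ^ b :: nat)) \<in> \<Omega>"
        using xy unfolding D'_def by (simp add: D.FactGroup_pow \<pi>.hom_commutator)
    qed
  qed
  show ?case
    unfolding commuting_powers_def
  proof (intro ballI allI impI)
    fix x y and a b :: nat
    assume xy: "x \<in> carrier G" "y \<in> carrier G" and ab: "a + b = s"
      and pow: "x [^] (2 ^ Suc s :: nat) \<in> D" "y [^] (2 ^ s :: nat) \<in> D"
    have "(D #> x) [^]\<^bsub>G Mod D\<^esub> (2 ^ Suc (a + b) :: nat) \<in> {\<one>\<^bsub>G Mod D\<^esub>}"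
      "(D #> y) [^]\<^bsub>G Mod D\<^esub> (2 ^ (a + b) :: nat) \<in> {\<one>\<^bsub>G Mod D\<^esub>}"
      using pow xy ab coset_eq_one_iff[OF less.prems] D.FactGroup_pow by (metis nat_pow_closed singletonI)+
    then have "commutator (G Mod D) ((D #> x) [^]\<^bsub>G Mod D\<^esub> (2 ^ a :: nat))
        ((D #> y) [^]\<^bsub>G Mod D\<^esub> (2 ^ b :: nat)) \<in> {\<one>\<^bsub>G Mod D\<^esub>}"
      using \<pi>.H.commuting_powersD cp ab xy \<pi>.hom_closed by metis
    then have "D #> comm (x [^] (2 ^ a :: nat)) (y [^] (2 ^ b :: nat)) = \<one>\<^bsub>G Mod D\<^esub>"
      using xy by (simp add: D.FactGroup_pow \<pi>.hom_commutator)
    then show "comm (x [^] (2 ^ a :: nat)) (y [^] (2 ^ b :: nat)) \<in> D"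
      using xy by (subst (asm) coset_eq_one_iff[OF less.prems]) simp_all
  qed
qed

end

section \<open>Normal subgroups contained in the fourth powers\<close>

lemma (in group) fourth_power_subgroup_subset: "power_subgroup G (carrier G) 4 \<subseteq> E 2"
proof (rule power_subgroup_leI[OF square_series_subgroup])
  fix x assume "x \<in> carrier G"
  then have "x [^] (2 ^ 2 :: nat) \<in> E (0 + 2)"
    by (intro pow_mem_square_series) simp
  moreover have "2 ^ 2 = (4 :: nat)" by simp
  ultimately show "x [^] (4 :: nat) \<in> E 2"
    by (simp only: add_0)
qed

lemma powerful_2_group_imp_powerful_two_group:
  assumes "powerful_2_group G"
  shows "powerful_two_group G"
proof -
  interpret group G
    using assms by (simp add: powerful_2_group_def finite_2_group_def)
  show ?thesis
  proof unfold_locales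
    show "finite (carrier G)" "\<exists>k. order G = 2 ^ k"
      using assms by (simp_all add: powerful_2_group_def finite_2_group_def)
    fix a b assume ab: "a \<in> carrier G" "b \<in> carrier G"
    have "commutator G a b \<in> derived G (carrier G)"
      unfolding derived_def commutator_def using ab by (intro generate.incl) blast
    also have "\<dots> \<subseteq> power_subgroup G (carrier G) 4"
      using assms by (simp add: powerful_2_group_def)
    also have "\<dots> \<subseteq> square_series G 2"
      by (rule fourth_power_subgroup_subset)
    finally show "commutator G a b \<in> square_series G 2" .
  qed
qed

context group
begin

lemma commutator_subgroup_leI:
  assumes "subgroup D G" "\<And>a b. a \<in> A \<Longrightarrow> b \<in> B \<Longrightarrow> comm a b \<in> D"
  shows "commutator_subgroup G A B \<subseteq> D"
  unfolding commutator_subgroup_def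
  using assms by (intro generate_subgroup_incl) (auto simp: commutator_def)

lemma power_subgroup_consistent:
  assumes "subgroup N G" "K \<subseteq> N"
  shows "power_subgroup (G\<lparr>carrier := N\<rparr>) K n = power_subgroup G K n"
proof -
  have "(\<lambda>x. x [^]\<^bsub>G\<lparr>carrier := N\<rparr>\<^esub> n) ` K = (\<lambda>x. x [^] n) ` K"
    by (simp add: nat_pow_consistent [symmetric])
  moreover have "(\<lambda>x. x [^] n) ` K \<subseteq> N"
    using assms subgroup_nat_pow_closed by blast
  ultimately show ?thesis
    unfolding power_subgroup_def using generate_consistent[OF _ assms(1)] by simp
qed

lemma commutator_subgroup_consistent:
  assumes N: "subgroup N G" and "A \<subseteq> N" "B \<subseteq> N"
  shows "commutator_subgroup (G\<lparr>carrier := N\<rparr>) A B = commutator_subgroup G A B"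
proof -
  have inv: "inv\<^bsub>G\<lparr>carrier := N\<rparr>\<^esub> x = inv x" if "x \<in> N" for x
    using m_inv_consistent[OF N that] .
  have "(\<Union>a\<in>A. \<Union>b\<in>B. {a \<otimes> b \<otimes> inv a \<otimes> inv b}) \<subseteq> N"
    using assms by (auto intro!: subgroup.m_closed[OF N] subgroup.m_inv_closed[OF N])
  moreover have "(\<Union>a\<in>A. \<Union>b\<in>B. {a \<otimes> b \<otimes> inv\<^bsub>G\<lparr>carrier := N\<rparr>\<^esub> a \<otimes> inv\<^bsub>G\<lparr>carrier := N\<rparr>\<^esub> b})
      = (\<Union>a\<in>A. \<Union>b\<in>B. {a \<otimes> b \<otimes> inv a \<otimes> inv b})"
    using inv subsetD[OF assms(2)] subsetD[OF assms(3)] by (intro SUP_cong refl) simp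
  ultimately show ?thesis
    unfolding commutator_subgroup_def using generate_consistent[OF _ N] by simp
qed

end

lemma (in powerful_two_group) finite_2_group_subgroup:
  assumes "subgroup N G"
  shows "finite_2_group (G\<lparr>carrier := N\<rparr>)"
proof -
  obtain k where "order G = 2 ^ k" using order_two_power by blast
  then have "card N dvd 2 ^ k"
    using lagrange[OF assms] by (metis dvd_triv_right)
  then have "\<exists>j. card N = 2 ^ j"
    using divides_primepow_nat two_is_prime_nat by blast
  moreover have "finite N"
    using finite_carrier finite_subset subgroup.subset[OF assms] by blast
  ultimately show ?thesis
    using subgroup_imp_group[OF assms] by (simp add: finite_2_group_def order_def)
qed

text \<open>The form in which the statement on orders is used: elements of \<open>E\<^sub>a\<close> and \<open>E\<^sub>b\<close> are powers with
  exponents \<open>2\<^sup>a\<close> and \<open>2\<^sup>b\<close>, so bounds on their own orders modulo \<open>D\<close> bound the orders of the roots.\<close>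

lemma (in powerful_two_group) comm_mem_of_roots:
  assumes D: "D \<lhd> G" and x: "x \<in> E a" and y: "y \<in> E b"
    and "x [^] (2 ^ Suc b :: nat) \<in> D" and "y [^] (2 ^ a :: nat) \<in> D"
  shows "comm x y \<in> D"
proof -
  obtain u where u: "u \<in> carrier G" "x = u [^] (2 ^ a :: nat)"
    using x by (rule two_power_root)
  obtain v where v: "v \<in> carrier G" "y = v [^] (2 ^ b :: nat)"
    using y by (rule two_power_root)
  have "u [^] (2 ^ Suc (a + b) :: nat) = x [^] (2 ^ Suc b :: nat)"
    using u by (simp add: nat_pow_pow power_add ac_simps)
  moreover have "v [^] (2 ^ (a + b) :: nat) = y [^] (2 ^ a :: nat)"
    using v by (simp add: nat_pow_pow power_add ac_simps)
  ultimately show ?thesis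
    using commuting_powersD[OF commuting_powers_normal[OF D] u(1) v(1)] u v assms(4,5) by simp
qed

theorem (in powerful_two_group) powerfully_nilpotent_normal_subgroup:
  assumes "N \<lhd> G" and NE: "N \<subseteq> E 2"
  shows "powerfully_nilpotent_2_group (G\<lparr>carrier := N\<rparr>)"
proof -
  interpret N: normal N G by fact
  note N = N.subgroup_axioms
  have "commutator_subgroup G N N \<subseteq> power_subgroup G N 4"
  proof (rule commutator_subgroup_leI)
    let ?D = "power_subgroup G N 4"
    show D: "subgroup ?D G"
      by (rule normal_imp_subgroup[OF power_subgroup_normal]) fact
    fix x y assume x: "x \<in> N" and y: "y \<in> N"
    have four: "z [^] (2 ^ 2 :: nat) \<in> ?D" if "z \<in> N" for z
      using pow_mem_power_subgroup[of z N 4] that by simp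
    have "x [^] (2 ^ Suc 2 :: nat) \<in> ?D"
      by (rule pow_two_power_subgroup_mono[OF D _ four[OF x]]) (use x in auto)
    then show "comm x y \<in> ?D"
      using comm_mem_of_roots[OF power_subgroup_normal[OF assms(1)], of x 2 y 2] four x y NE by blast
  qed
  then have powerful: "powerful_2_group (G\<lparr>carrier := N\<rparr>)"
    using finite_2_group_subgroup[OF N] commutator_subgroup_self[of "G\<lparr>carrier := N\<rparr>" N]
      commutator_subgroup_consistent[OF N, of N N] power_subgroup_consistent[OF N, of N 4]
    by (simp add: powerful_2_group_def)
  obtain m where m: "E m = {\<one>}"
    using square_series_eventually_trivial by blast
  \<comment> \<open>The offset 2 makes the chain end at \<open>N \<inter> E\<^sub>2 = N\<close>.\<close>
  define H where "H i = N \<inter> E (m + 2 - i)" for i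
  have H_normal: "H i \<lhd> G" for i
    unfolding H_def using assms(1) square_series_normal by (rule normal_subgroup_intersect)
  have H_sub: "subgroup (H i) G" for i
    by (rule normal_imp_subgroup[OF H_normal])
  have H_N: "H i \<subseteq> N" for i by (simp add: H_def)
  have step: "commutator_subgroup G (H (Suc i)) N \<subseteq> power_subgroup G (H i) 2" if "i < m" for i
  proof (rule commutator_subgroup_leI)
    let ?D = "power_subgroup G (H i) 2"
    show D: "subgroup ?D G"
      by (rule normal_imp_subgroup[OF power_subgroup_normal[OF H_normal]])
    \<comment> \<open>The step concerns \<open>N \<inter> E\<^sub>k\<^sub>+\<^sub>2\<close> and the squares of \<open>N \<inter> E\<^sub>k\<^sub>+\<^sub>3\<close>.\<close>
    define k where "k = m - i - 1"
    have k: "m + 2 - Suc i = k + 2" "m + 2 - i = k + 3"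
      using that by (simp_all add: k_def)
    have Hk: "H i = N \<inter> E (k + 3)" "H (Suc i) = N \<inter> E (k + 2)"
      unfolding H_def k by simp_all
    have sq: "z [^] (2 ^ Suc n :: nat) \<in> ?D" if "z \<in> N" "z \<in> E j" "k + 3 \<le> j + n" for z j n
    proof -
      have "z [^] (2 ^ n :: nat) \<in> E (j + n)"
        using that(2) by (rule pow_mem_square_series)
      then have "z [^] (2 ^ n :: nat) \<in> H i"
        using that subgroup_nat_pow_closed[OF N] square_series_antimono[of "k + 3" "j + n"]
        by (auto simp: Hk)
      then have "(z [^] (2 ^ n :: nat)) [^] (2 :: nat) \<in> ?D"
        by (rule pow_mem_power_subgroup)
      then show ?thesis
        using that(1) by (simp add: nat_pow_pow mult.commute)
    qed
    fix x y assume x: "x \<in> H (Suc i)" and y: "y \<in> N"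
    have x': "x \<in> N" "x \<in> E (k + 2)" and y': "y \<in> E 2"
      using x y NE by (auto simp: Hk)
    have "x [^] (2 ^ Suc 2 :: nat) \<in> ?D"
      using x' by (intro sq) auto
    moreover have "y [^] (2 ^ Suc (k + 1) :: nat) \<in> ?D"
      using y y' by (intro sq) auto
    ultimately show "comm x y \<in> ?D"
      using comm_mem_of_roots[OF power_subgroup_normal[OF H_normal] x'(2) y'] by simp
  qed
  have "H 0 = {\<one>}"
    using square_series_antimono[of m "m + 2"] m N.one_closed square_series_one[of "m + 2"]
    by (auto simp: H_def)
  moreover have "H m = N"
    using NE by (auto simp: H_def)
  moreover have "subgroup (H i) (G\<lparr>carrier := N\<rparr>)" for i
    using subgroup_incl[OF H_sub N H_N] .
  moreover have "H i \<subseteq> H (Suc i)" for i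
    unfolding H_def by (intro Int_mono order_refl square_series_antimono diff_le_mono2) simp
  moreover have "commutator_subgroup (G\<lparr>carrier := N\<rparr>) (H (Suc i)) N
      \<subseteq> power_subgroup (G\<lparr>carrier := N\<rparr>) (H i) 2" if "i < m" for i
    using step[OF that] commutator_subgroup_consistent[OF N H_N order_refl]
      power_subgroup_consistent[OF N H_N] by simp
  ultimately have "\<exists>(n::nat) H. H 0 = {\<one>} \<and> H n = N \<and>
      (\<forall>i\<le>n. subgroup (H i) (G\<lparr>carrier := N\<rparr>)) \<and> (\<forall>i<n. H i \<subseteq> H (Suc i)) \<and>
      (\<forall>i<n. commutator_subgroup (G\<lparr>carrier := N\<rparr>) (H (Suc i)) N
        \<subseteq> power_subgroup (G\<lparr>carrier := N\<rparr>) (H i) 2)"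
    by (intro exI[of _ m] exI[of _ H]) simp
  then show ?thesis
    using powerful by (simp add: powerfully_nilpotent_2_group_def)
qed

theorem theorem8:
  fixes G :: "('a, 'b) monoid_scheme" and N :: "'a set"
  assumes "powerful_2_group G"
    and "N \<lhd> G"
    and "N \<subseteq> power_subgroup G (carrier G) 4"
  shows "powerfully_nilpotent_2_group (G\<lparr>carrier := N\<rparr>)"
proof -
  interpret powerful_two_group G
    by (rule powerful_2_group_imp_powerful_two_group) fact
  show ?thesis
    using assms(2,3) fourth_power_subgroup_subset
    by (blast intro: powerfully_nilpotent_normal_subgroup)
qed

end
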